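(* Let $X$ be a real Banach space and $D\subseteq X$. Let $A:D\to 2^X$ with $0\in Aq$ be uniformly accretive at zero with modulus $\Theta$, and let $A_n:D\to 2^X$ ($n\in\mathbb{N}$) be a sequence of accretive operators, each satisfying the range condition $D\subset (I+sA_n)(D)$ for all $s>0$, such that $(A_n)$ approximates $A$ with respect to $(h_n)$ and some $\xi:[0,\infty)\to[0,\infty)$. Let $\phi:(0,\infty)\to\mathbb{N}$ be a rate of convergence for $h_n\to 0$ and $\xi^\ast:(0,\infty)\to(0,\infty)$ a function satisfying $$\forall x,y\in[0,\infty)\ (x\leq y\wedge y>0\to\xi(x)\leq\xi^\ast(y)).$$ In addition, let $(\alpha_i)$ be a sequence of nonnegative reals such that $\sum_{i=0}^\infty\alpha_i=\infty$ with rate of divergence $r$ and $\sum_{i=0}^\infty\alpha_ih_i<\infty$, and suppose that $(x_n)$ and $(u_n)$ are sequences satisfying $x_n\in D$ and $$x_{n+1}=x_n-\alpha_nu_n,\qquad u_n\in A_nx_{n+1}$$ for all $n\in\mathbb{N}$. Finally, suppose that $K_0,K_1,K_2\in(0,\infty)$ satisfy $\|x_0-q\|<K_0$, $\|q\|<K_1$ and $\sum_{i=0}^n\alpha_ih_i<K_2$ for all $n\in\mathbb{N}$. Then $\|x_n-q\|\to 0$ with rate of convergence $$\Phi_{\Theta,\phi,\xi^\ast,r,K_0,K_1,K_2}(\varepsilon):=r\left(\phi\left(\frac{\Theta_K(\varepsilon)}{3K\cdot\xi^\ast(K+K_1)}\right),\frac{K^2}{\Theta_K(\varepsilon)}\right)+1$$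 for $K:=K_0+K_2\cdot\xi^\ast(K_1)$.
   Context: $\mathbb{N}=\{0,1,2,\ldots\}$. $X$ is a real Banach space with dual $X^\ast$; the normalized duality mapping $J:X\to 2^{X^\ast}$ is $J(x):=\{j\in X^\ast : \langle x,j\rangle=\|x\|^2=\|j\|^2\}$. An operator on $X$ is a mapping $A:X\to 2^X$, with domain $D(A):=\{x\in X: Ax\neq\emptyset\}$; $(x,u)\in A$ means $u\in Ax$. Here the operators $A$ and $A_n$ have common domain $D(A)=D(A_n)=D$. $(I+sA_n)(D)=\{x+su : x\in D,\ u\in A_nx\}$. $A$ is accretive if for all $u\in Ax$ and $v\in Ay$ there exists $j\in J(x-y)$ with $\langle u-v,j\rangle\geq 0$. An accretive operator $A:D(A)\to 2^X$ with $0\in Aq$ is uniformly accretive at zero if for all $\varepsilon,K>0$ there exists $\delta>0$ such that $$(\ast)\quad \forall (x,u)\in A\ \big(\|x-q\|\in[\varepsilon,K]\to \exists j\in J(x-q)\ (\langle u,j\rangle\geq\delta)\big).$$ A function $\Theta_{(\cdot)}(\cdot):(0,\infty)\times(0,\infty)\to(0,\infty)$ such that $\delta:=\Theta_K(\varepsilon)$ satisfies $(\ast)$ for all $\varepsilon,K>0$ is called a modulus of uniform accretivity at zero for $A$. $(A_n)$ approximates $A$ with respect to $(h_n)$ and $\xi:[0,\infty)\to[0,\infty)$ if $(h_n)$ is a sequence of positive reals with $h_n\to 0$ and $$\forall x\in D\ \forall n\in\mathbb{N}\ \big(H(A_nx,Ax)\leq h_n\xi(\|x\|)\big),$$ where $H(P,Q)=\max\{\sup_{u\in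 P}\inf_{v\in Q}\|u-v\|,\ \sup_{v\in Q}\inf_{u\in P}\|u-v\|\}$ is the Hausdorff distance. A rate of convergence for a sequence of nonnegative reals $a_n\to 0$ is a function $\phi:(0,\infty)\to\mathbb{N}$ with $\forall\varepsilon>0\ \forall n\geq\phi(\varepsilon)\ (a_n\leq\varepsilon)$. A rate (or modulus) of divergence for $\sum_{i=0}^\infty\alpha_i=\infty$ (with $\alpha_i\ge 0$) is a function $r:\mathbb{N}\times(0,\infty)\to\mathbb{N}$ with $\sum_{i=N}^{r(N,x)}\alpha_i\geq x$ for all $N\in\mathbb{N}$, $x>0$, where $\sum_{i=N}^m\alpha_i=0$ if $m<N$. *)

theory Defs
  imports "HOL-Analysis.Analysis"
begin

text \<open>The dual of \<open>'a\<close> is the type \<open>'a \<Rightarrow>\<^sub>L real\<close> of bounded linear functionals with the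
  operator norm; the pairing of \<open>x\<close> and \<open>j\<close> is \<open>blinfun_apply j x\<close>.\<close>

definition duality_map :: "'a::banach \<Rightarrow> ('a \<Rightarrow>\<^sub>L real) set" where
  "duality_map x = {j. blinfun_apply j x = (norm x)\<^sup>2 \<and> (norm x)\<^sup>2 = (norm j)\<^sup>2}"

definition op_dom :: "('a \<Rightarrow> 'a set) \<Rightarrow> 'a set" where
  "op_dom A = {x. A x \<noteq> {}}"

definition accretive :: "('a::banach \<Rightarrow> 'a set) \<Rightarrow> bool" where
  "accretive A \<longleftrightarrow>
     (\<forall>x y. \<forall>u\<in>A x. \<forall>v\<in>A y. \<exists>j\<in>duality_map (x - y). blinfun_apply j (u - v) \<ge> 0)"

definition range_condition :: "('a::banach \<Rightarrow> 'a set) \<Rightarrow> 'a set \<Rightarrow> bool" where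
  "range_condition A D \<longleftrightarrow> (\<forall>s>0. D \<subseteq> {x + s *\<^sub>R u |x u. x \<in> D \<and> u \<in> A x})"

definition accretive_bound :: "('a::banach \<Rightarrow> 'a set) \<Rightarrow> 'a \<Rightarrow> real \<Rightarrow> real \<Rightarrow> real \<Rightarrow> bool" where
  "accretive_bound A q \<epsilon> K \<delta> \<longleftrightarrow>
     (\<forall>x. \<forall>u\<in>A x. norm (x - q) \<in> {\<epsilon>..K} \<longrightarrow>
        (\<exists>j\<in>duality_map (x - q). blinfun_apply j u \<ge> \<delta>))"

definition uniformly_accretive_at_zero :: "('a::banach \<Rightarrow> 'a set) \<Rightarrow> 'a \<Rightarrow> bool" where
  "uniformly_accretive_at_zero A q \<longleftrightarrow>
     accretive A \<and> 0 \<in> A q \<and> (\<forall>\<epsilon>>0. \<forall>K>0. \<exists>\<delta>>0. accretive_bound A q \<epsilon> K \<delta>)"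

text \<open>Functions on \<open>(0,\<infinity>)\<close> or \<open>[0,\<infinity>)\<close> are total functions on \<open>real\<close>, constrained only on
  the intended domain; \<open>\<Theta> K \<epsilon>\<close> stands for \<open>\<Theta>\<^sub>K(\<epsilon>)\<close>.\<close>

definition uniform_accretivity_modulus ::
    "(real \<Rightarrow> real \<Rightarrow> real) \<Rightarrow> ('a::banach \<Rightarrow> 'a set) \<Rightarrow> 'a \<Rightarrow> bool" where
  "uniform_accretivity_modulus \<Theta> A q \<longleftrightarrow>
     (\<forall>\<epsilon>>0. \<forall>K>0. \<Theta> K \<epsilon> > 0 \<and> accretive_bound A q \<epsilon> K (\<Theta> K \<epsilon>))"

text \<open>Values of operators may be unbounded, so the Hausdorff distance lives in \<open>[0,\<infinity>]\<close>.\<close>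

definition hausdorff_distance :: "'a::real_normed_vector set \<Rightarrow> 'a set \<Rightarrow> ennreal" where
  "hausdorff_distance P Q =
     max (SUP u\<in>P. INF v\<in>Q. ennreal (norm (u - v))) (SUP v\<in>Q. INF u\<in>P. ennreal (norm (u - v)))"

definition approximates ::
    "(nat \<Rightarrow> 'a::banach \<Rightarrow> 'a set) \<Rightarrow> ('a \<Rightarrow> 'a set) \<Rightarrow> 'a set \<Rightarrow> (nat \<Rightarrow> real) \<Rightarrow> (real \<Rightarrow> real) \<Rightarrow> bool" where
  "approximates An A D h \<xi> \<longleftrightarrow>
     (\<forall>n. h n > 0) \<and> h \<longlonglongrightarrow> 0 \<and>
     (\<forall>x\<in>D. \<forall>n. hausdorff_distance (An n x) (A x) \<le> ennreal (h n * \<xi> (norm x)))"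

definition rate_of_convergence :: "(real \<Rightarrow> nat) \<Rightarrow> (nat \<Rightarrow> real) \<Rightarrow> bool" where
  "rate_of_convergence \<phi> a \<longleftrightarrow> (\<forall>\<epsilon>>0. \<forall>n\<ge>\<phi> \<epsilon>. a n \<le> \<epsilon>)"

definition rate_of_divergence :: "(nat \<Rightarrow> real \<Rightarrow> nat) \<Rightarrow> (nat \<Rightarrow> real) \<Rightarrow> bool" where
  "rate_of_divergence r \<alpha> \<longleftrightarrow> (\<forall>N. \<forall>x>0. (\<Sum>i=N..r N x. \<alpha> i) \<ge> x)"

definition Phi_rate ::
    "(real \<Rightarrow> real \<Rightarrow> real) \<Rightarrow> (real \<Rightarrow> nat) \<Rightarrow> (real \<Rightarrow> real) \<Rightarrow> (nat \<Rightarrow> real \<Rightarrow> nat) \<Rightarrow>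
     real \<Rightarrow> real \<Rightarrow> real \<Rightarrow> real \<Rightarrow> nat" where
  "Phi_rate \<Theta> \<phi> \<xi>s r K0 K1 K2 \<epsilon> =
     (let K = K0 + K2 * \<xi>s K1
      in r (\<phi> (\<Theta> K \<epsilon> / (3 * K * \<xi>s (K + K1)))) (K\<^sup>2 / \<Theta> K \<epsilon>) + 1)"

end

theory Submission
  imports Defs
begin

text \<open>Pairing the implicit step with a suitable \<open>j \<in> J(x\<^sub>n\<^sub>+\<^sub>1 - q)\<close> gives
  \<open>\<parallel>x\<^sub>n\<^sub>+\<^sub>1 - q\<parallel>\<^sup>2 \<le> \<parallel>x\<^sub>n - q\<parallel> \<parallel>x\<^sub>n\<^sub>+\<^sub>1 - q\<parallel> - \<alpha>\<^sub>n \<langle>u\<^sub>n, j\<rangle>\<close>. Comparing \<open>u\<^sub>n\<close> with elements of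
  \<open>A\<^sub>n q\<close> close to \<open>0 \<in> A q\<close> shows that the iterates stay within distance \<open>K\<close> of \<open>q\<close>. Comparing it
  instead with elements of \<open>A x\<^sub>n\<^sub>+\<^sub>1\<close> shows that, once the approximation error is small and as
  long as \<open>\<parallel>x\<^sub>n\<^sub>+\<^sub>1 - q\<parallel> \<ge> \<epsilon>\<close>, the squared distance drops by \<open>4/3 \<alpha>\<^sub>n \<Theta>\<^sub>K(\<epsilon>)\<close>. The divergence of
  \<open>\<Sum>\<alpha>\<^sub>i\<close> forces the distance below \<open>\<epsilon>\<close>, and it cannot leave that ball again.\<close>

lemma hausdorff_distance_commute: "hausdorff_distance P Q = hausdorff_distance Q P"
  by (simp add: hausdorff_distance_def max.commute norm_minus_commute)

text \<open>The infimum in the distance need not be attained; the slack \<open>\<eta>\<close> turns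
  it into an actual witness.\<close>

lemma hausdorff_distance_approx:
  assumes "hausdorff_distance P Q \<le> ennreal c" "0 \<le> c" "0 < \<eta>" "u \<in> P"
  obtains v where "v \<in> Q" "norm (u - v) < c + \<eta>"
proof -
  have "(INF v\<in>Q. ennreal (norm (u - v))) \<le> (SUP u\<in>P. INF v\<in>Q. ennreal (norm (u - v)))"
    using \<open>u \<in> P\<close> by (rule SUP_upper)
  also have "\<dots> \<le> ennreal c"
    using assms(1) by (simp add: hausdorff_distance_def)
  also have "\<dots> < ennreal (c + \<eta>)"
    using assms by (simp add: ennreal_less_iff)
  finally obtain v where "v \<in> Q" "ennreal (norm (u - v)) < ennreal (c + \<eta>)"
    by (auto simp: INF_less_iff)
  with that show thesis
    by (simp add: ennreal_less_iff)
qed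

text \<open>A Cauchy-Schwarz substitute: \<open>j\<close> has operator norm
  \<open>norm x\<close>.\<close>

lemma duality_map_abs_le:
  assumes "j \<in> duality_map x"
  shows "\<bar>blinfun_apply j z\<bar> \<le> norm x * norm z"
proof -
  have "norm j = norm x"
    using assms by (auto simp: duality_map_def intro: power2_eq_imp_eq)
  then show ?thesis
    using norm_blinfun[of j z] by simp
qed

lemma duality_map_step:
  assumes "j \<in> duality_map (y - q)" "y = x - a *\<^sub>R u"
  shows "(norm (y - q))\<^sup>2 \<le> norm (x - q) * norm (y - q) - a * blinfun_apply j u"
proof -
  have "(norm (y - q))\<^sup>2 = blinfun_apply j (y - q)"
    using assms(1) by (simp add: duality_map_def)
  also have "\<dots> = blinfun_apply j (x - q) - a * blinfun_apply j u"
    by (simp add: assms(2) blinfun.diff_right blinfun.scaleR_right blinfun.add_right)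
  also have "\<dots> \<le> norm (x - q) * norm (y - q) - a * blinfun_apply j u"
    using duality_map_abs_le[OF assms(1), of "x - q"] by (simp add: mult.commute)
  finally show ?thesis .
qed

text \<open>Choose \<open>v\<close> in \<open>B q\<close> of norm at most about \<open>c\<close>.
  Accretivity of \<open>B\<close> between \<open>(y, u)\<close> and \<open>(q, v)\<close> bounds the
  pairing of \<open>u\<close> below by about \<open>- norm (y - q) * c\<close>, and a factor
  \<open>norm (y - q)\<close> cancels.\<close>

lemma accretive_implicit_step_le:
  assumes "accretive B" "u \<in> B y" "y = x - a *\<^sub>R u" "0 \<le> a"
    and "hausdorff_distance (B q) (A q) \<le> ennreal c" "0 \<le> c" "0 \<in> A q"
  shows "norm (y - q) \<le> norm (x - q) + a * c"
proof (rule field_le_epsilon)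
  fix e :: real
  assume "0 < e"
  \<comment> \<open>The \<open>+ 1\<close> keeps the denominator positive when
    \<open>a = 0\<close>.\<close>
  define \<eta> where "\<eta> = e / (a + 1)"
  have "0 < \<eta>" "a * \<eta> \<le> e"
    using \<open>0 < e\<close> \<open>0 \<le> a\<close> by (auto simp: \<eta>_def field_simps)
  obtain v where v: "v \<in> B q" "norm v < c + \<eta>"
    using hausdorff_distance_approx[OF _ \<open>0 \<le> c\<close> \<open>0 < \<eta>\<close> \<open>0 \<in> A q\<close>, of "B q"] assms(5)
    by (auto simp: hausdorff_distance_commute)
  obtain j where j: "j \<in> duality_map (y - q)" "0 \<le> blinfun_apply j (u - v)"
    using assms(1,2) v(1) unfolding accretive_def by blast
  have "- blinfun_apply j u \<le> norm (y - q) * norm v"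
    using duality_map_abs_le[OF j(1), of v] j(2) by (simp add: blinfun.diff_right)
  also have "\<dots> \<le> norm (y - q) * (c + \<eta>)"
    using v(2) by (intro mult_left_mono) auto
  finally have "a * (- blinfun_apply j u) \<le> a * (norm (y - q) * (c + \<eta>))"
    using \<open>0 \<le> a\<close> by (rule mult_left_mono)
  with duality_map_step[OF j(1) assms(3)]
  have "norm (y - q) * norm (y - q) \<le> norm (y - q) * (norm (x - q) + a * (c + \<eta>))"
    by (simp add: power2_eq_square algebra_simps)
  then have "norm (y - q) \<le> norm (x - q) + a * (c + \<eta>)"
    using \<open>0 \<le> a\<close> \<open>0 \<le> c\<close> \<open>0 < \<eta>\<close> by (cases "norm (y - q) = 0") (auto simp: mult_le_cancel_left)
  with \<open>a * \<eta> \<le> e\<close> show "norm (y - q) \<le> norm (x - q) + a * c + e"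
    by (simp add: algebra_simps)
qed

text \<open>The bound \<open>\<delta>\<close> concerns \<open>A\<close>, while \<open>u\<close> lies
  in \<open>B y\<close>: passing to a nearby \<open>w\<close> in \<open>A y\<close> costs about
  \<open>K * c\<close> in the pairing. The factor 2 arises because AM-GM on the mixed product lets
  half of \<open>(norm (y - q))\<^sup>2\<close> be absorbed on the left.\<close>

lemma uniformly_accretive_implicit_step_le:
  assumes "accretive_bound A q \<epsilon> K \<delta>" "norm (y - q) \<in> {\<epsilon>..K}"
    and "u \<in> B y" "y = x - a *\<^sub>R u" "0 \<le> a"
    and "hausdorff_distance (B y) (A y) \<le> ennreal c" "0 \<le> c"
  shows "(norm (y - q))\<^sup>2 \<le> (norm (x - q))\<^sup>2 - 2 * a * (\<delta> - K * c)"
proof (rule field_le_epsilon)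
  fix e :: real
  assume "0 < e"
  have "0 \<le> K"
    using assms(2) by (auto intro: order_trans[OF norm_ge_zero])
  define \<eta> where "\<eta> = e / (2 * a * K + 1)"
  have "0 \<le> 2 * a * K"
    using \<open>0 \<le> K\<close> \<open>0 \<le> a\<close> by simp
  then have "0 < \<eta>" "2 * a * K * \<eta> \<le> e"
    using \<open>0 < e\<close> by (auto simp: \<eta>_def field_simps)
  obtain w where w: "w \<in> A y" "norm (u - w) < c + \<eta>"
    using hausdorff_distance_approx[OF assms(6,7) \<open>0 < \<eta>\<close> \<open>u \<in> B y\<close>] by blast
  \<comment> \<open>\<open>w\<close> is fixed first, since the functional supplied by the bound may
    depend on it.\<close>
  obtain j where j: "j \<in> duality_map (y - q)" "\<delta> \<le> blinfun_apply j w"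
    using assms(1,2) w(1) unfolding accretive_bound_def by blast
  have "blinfun_apply j w - blinfun_apply j u \<le> norm (y - q) * norm (u - w)"
    using duality_map_abs_le[OF j(1), of "u - w"] by (simp add: blinfun.diff_right)
  also have "\<dots> \<le> K * (c + \<eta>)"
    using assms(2) w(2) \<open>0 \<le> K\<close> by (intro mult_mono) auto
  finally have "a * (\<delta> - K * (c + \<eta>)) \<le> a * blinfun_apply j u"
    using j(2) \<open>0 \<le> a\<close> by (intro mult_left_mono) auto
  moreover have "2 * (norm (x - q) * norm (y - q)) \<le> (norm (x - q))\<^sup>2 + (norm (y - q))\<^sup>2"
    using sum_squares_bound[of "norm (x - q)" "norm (y - q)"] by simp
  ultimately have "(norm (y - q))\<^sup>2 \<le> (norm (x - q))\<^sup>2 - 2 * (a * (\<delta> - K * (c + \<eta>)))"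
    using duality_map_step[OF j(1) assms(4)] by linarith
  with \<open>2 * a * K * \<eta> \<le> e\<close>
  show "(norm (y - q))\<^sup>2 \<le> (norm (x - q))\<^sup>2 - 2 * a * (\<delta> - K * c) + e"
    by (simp add: algebra_simps)
qed

text \<open>Staying at or above \<open>\<epsilon>\<close> on the whole range would telescope to a
  decrease of the squares exceeding \<open>(b N)\<^sup>2\<close>. After a value below
  \<open>\<epsilon>\<close>, any value above it would trigger \<open>descent\<close> and so be at
  most its predecessor.\<close>

lemma le_of_descent:
  fixes b \<alpha> :: "nat \<Rightarrow> real"
  assumes b_nonneg: "\<And>n. 0 \<le> b n" and a_nonneg: "\<And>n. 0 \<le> \<alpha> n" and "0 < \<epsilon>" "0 \<le> c"
    and descent: "\<And>n. N \<le> n \<Longrightarrow> \<epsilon> \<le> b (Suc n) \<Longrightarrow> (b (Suc n))\<^sup>2 \<le> (b n)\<^sup>2 - c * \<alpha> n"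
    and large: "(b N)\<^sup>2 < c * (\<Sum>i=N..M. \<alpha> i)"
    and "Suc M \<le> n"
  shows "b n \<le> \<epsilon>"
proof -
  have "\<exists>i\<in>{N..M}. b (Suc i) < \<epsilon>"
  proof (rule ccontr)
    assume "\<not> ?thesis"
    then have above: "\<epsilon> \<le> b (Suc i)" if "N \<le> i" "i \<le> M" for i
      using that by (auto simp: not_less)
    \<comment> \<open>On an empty range \<open>large\<close> would make a square negative.\<close>
    have "N \<le> M"
      using large by (cases "N \<le> M") auto
    have "(\<Sum>i=N..M. c * \<alpha> i) \<le> (\<Sum>i=N..M. (b i)\<^sup>2 - (b (Suc i))\<^sup>2)"
      using descent above by (intro sum_mono) (fastforce simp: algebra_simps)
    also have "\<dots> = (b N)\<^sup>2 - (b (Suc M))\<^sup>2"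
      using sum_Suc_diff[of N M "\<lambda>i. - (b i)\<^sup>2"] \<open>N \<le> M\<close> by simp
    finally have "c * (\<Sum>i=N..M. \<alpha> i) \<le> (b N)\<^sup>2"
      using zero_le_power2[of "b (Suc M)"] unfolding sum_distrib_left by linarith
    with large show False
      by simp
  qed
  then obtain i where i: "N \<le> i" "i \<le> M" "b (Suc i) < \<epsilon>"
    by auto
  have "Suc i \<le> n"
    using i \<open>Suc M \<le> n\<close> by simp
  then show ?thesis
  proof (induction n rule: dec_induct)
    case base
    then show ?case
      using i by simp
  next
    case (step m)
    show ?case
    proof (rule ccontr)
      assume "\<not> b (Suc m) \<le> \<epsilon>"
      then have "(b (Suc m))\<^sup>2 \<le> (b m)\<^sup>2 - c * \<alpha> m"
        using i step by (intro descent) auto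
      also have "\<dots> \<le> (b m)\<^sup>2"
        using \<open>0 \<le> c\<close> a_nonneg by simp
      also have "\<dots> \<le> \<epsilon>\<^sup>2"
        using step.IH b_nonneg by (intro power_mono) auto
      finally have "b (Suc m) \<le> \<epsilon>"
        using \<open>0 < \<epsilon>\<close> by (auto intro: power2_le_imp_le)
      with \<open>\<not> b (Suc m) \<le> \<epsilon>\<close> show False
        by simp
    qed
  qed
qed

theorem theorem5p7:
  fixes D :: "'a::banach set"
    and A :: "'a \<Rightarrow> 'a set"
    and An :: "nat \<Rightarrow> 'a \<Rightarrow> 'a set"
    and q :: 'a
    and \<Theta> :: "real \<Rightarrow> real \<Rightarrow> real"
    and h \<alpha> :: "nat \<Rightarrow> real"
    and \<xi> \<xi>s :: "real \<Rightarrow> real"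
    and \<phi> :: "real \<Rightarrow> nat"
    and r :: "nat \<Rightarrow> real \<Rightarrow> nat"
    and x u :: "nat \<Rightarrow> 'a"
    and K0 K1 K2 :: real
  assumes "op_dom A = D"
    and "\<And>n. op_dom (An n) = D"
    and "uniformly_accretive_at_zero A q"
    and "uniform_accretivity_modulus \<Theta> A q"
    and "\<And>n. accretive (An n)"
    and "\<And>n. range_condition (An n) D"
    and "\<And>t. t \<ge> 0 \<Longrightarrow> \<xi> t \<ge> 0"
    and "approximates An A D h \<xi>"
    and "rate_of_convergence \<phi> h"
    and "\<And>t. t > 0 \<Longrightarrow> \<xi>s t > 0"
    and "\<And>s t. 0 \<le> s \<Longrightarrow> 0 \<le> t \<Longrightarrow> s \<le> t \<Longrightarrow> t > 0 \<Longrightarrow> \<xi> s \<le> \<xi>s t"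
    and "\<And>i. \<alpha> i \<ge> 0"
    and "filterlim (\<lambda>n. \<Sum>i\<le>n. \<alpha> i) at_top sequentially"
    and "rate_of_divergence r \<alpha>"
    and "summable (\<lambda>i. \<alpha> i * h i)"
    and "\<And>n. x n \<in> D"
    and "\<And>n. x (Suc n) = x n - \<alpha> n *\<^sub>R u n"
    and "\<And>n. u n \<in> An n (x (Suc n))"
    and "K0 > 0" and "K1 > 0" and "K2 > 0"
    and "norm (x 0 - q) < K0"
    and "norm q < K1"
    and "\<And>n. (\<Sum>i\<le>n. \<alpha> i * h i) < K2"
  shows "(\<lambda>n. norm (x n - q)) \<longlonglongrightarrow> 0 \<and>
         rate_of_convergence (Phi_rate \<Theta> \<phi> \<xi>s r K0 K1 K2) (\<lambda>n. norm (x n - q))"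
proof -
  note acc = assms(5) and approx = assms(8) and phi = assms(9)
    and xis_pos = assms(10) and xi_le = assms(11) and a_nonneg = assms(12) and div = assms(14)
    and x_in = assms(16) and x_Suc = assms(17) and u_in = assms(18)
    and K_pos = assms(19-21) and sum_bound = assms(24)
  \<comment> \<open>\<open>K0\<close> covers the initial distance; \<open>K2 * \<xi>s K1\<close>
    covers the accumulated approximation errors at \<open>q\<close>, whose norm is below
    \<open>K1\<close>.\<close>
  define K where "K = K0 + K2 * \<xi>s K1"
  have "0 < K"
    unfolding K_def using K_pos xis_pos by (simp add: add_pos_pos)
  have zero_in: "0 \<in> A q" and q_in: "q \<in> D"
    using assms(1,3) by (auto simp: uniformly_accretive_at_zero_def op_dom_def)
  have h_pos: "0 < h n" for n
    using approx by (simp add: approximates_def)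
  \<comment> \<open>The majorant makes the error uniform over a ball; it is used at \<open>q\<close>
    with \<open>t = K1\<close> and at the iterates with \<open>t = K + K1\<close>.\<close>
  have close: "hausdorff_distance (An n z) (A z) \<le> ennreal (h n * \<xi>s t)"
    if "z \<in> D" "norm z \<le> t" "0 < t" for n z t
  proof -
    have "hausdorff_distance (An n z) (A z) \<le> ennreal (h n * \<xi> (norm z))"
      using approx that by (simp add: approximates_def)
    also have "\<dots> \<le> ennreal (h n * \<xi>s t)"
      using that h_pos[of n] by (intro ennreal_leI mult_left_mono xi_le) auto
    finally show ?thesis .
  qed
  have x_le: "norm (x n - q) \<le> norm (x 0 - q) + \<xi>s K1 * (\<Sum>i<n. \<alpha> i * h i)" for n
  proof (induction n)
    case (Suc n)
    have "norm (x (Suc n) - q) \<le> norm (x n - q) + \<alpha> n * (h n * \<xi>s K1)"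
      using acc u_in x_Suc a_nonneg close[OF q_in _ K_pos(2)] zero_in assms(23)
        h_pos[of n] xis_pos[OF K_pos(2)]
      by (intro accretive_implicit_step_le[where B = "An n" and A = A]) auto
    with Suc show ?case
      by (simp add: algebra_simps)
  qed simp
  have bounded: "norm (x n - q) \<le> K" for n
  proof -
    have "(\<Sum>i<n. \<alpha> i * h i) \<le> (\<Sum>i\<le>n. \<alpha> i * h i)"
      using a_nonneg h_pos by (intro sum_mono2) (auto simp: less_imp_le)
    then have "\<xi>s K1 * (\<Sum>i<n. \<alpha> i * h i) \<le> \<xi>s K1 * K2"
      using sum_bound[of n] xis_pos[OF K_pos(2)] by (intro mult_left_mono) auto
    with x_le[of n] assms(22) show ?thesis
      by (simp add: K_def mult.commute)
  qed
  have rate: "norm (x n - q) \<le> \<epsilon>"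
    if "0 < \<epsilon>" and n: "Phi_rate \<Theta> \<phi> \<xi>s r K0 K1 K2 \<epsilon> \<le> n" for \<epsilon> n
  proof -
    define \<delta> where "\<delta> = \<Theta> K \<epsilon>"
    define L where "L = \<xi>s (K + K1)"
    \<comment> \<open>From \<open>N\<close> on, the error \<open>K * (h m * L)\<close> takes at most
      a third of \<open>\<delta>\<close>; twice the remainder is
      \<open>4 / 3 * \<delta>\<close>.\<close>
    define N where "N = \<phi> (\<delta> / (3 * K * L))"
    define M where "M = r N (K\<^sup>2 / \<delta>)"
    have "0 < \<delta>" and bound: "accretive_bound A q \<epsilon> K \<delta>"
      using assms(4) \<open>0 < \<epsilon>\<close> \<open>0 < K\<close> by (auto simp: uniform_accretivity_modulus_def \<delta>_def)
    have "0 < L"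
      using xis_pos \<open>0 < K\<close> K_pos by (simp add: L_def)
    have descent: "(norm (x (Suc m) - q))\<^sup>2 \<le> (norm (x m - q))\<^sup>2 - (4 / 3 * \<delta>) * \<alpha> m"
      if "N \<le> m" "\<epsilon> \<le> norm (x (Suc m) - q)" for m
    proof -
      have "norm (x (Suc m)) \<le> K + K1"
        using norm_triangle_ineq[of "x (Suc m) - q" q] bounded[of "Suc m"] assms(23) by simp
      then have "hausdorff_distance (An m (x (Suc m))) (A (x (Suc m))) \<le> ennreal (h m * L)"
        unfolding L_def using x_in \<open>0 < K\<close> K_pos by (intro close) auto
      then have "(norm (x (Suc m) - q))\<^sup>2 \<le> (norm (x m - q))\<^sup>2 - 2 * \<alpha> m * (\<delta> - K * (h m * L))"
        using that bounded[of "Suc m"] a_nonneg h_pos[of m] \<open>0 < L\<close>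
        by (intro uniformly_accretive_implicit_step_le[where B = "An m", OF bound _ u_in x_Suc]) auto
      moreover have "h m \<le> \<delta> / (3 * K * L)"
        using phi that(1) \<open>0 < \<delta>\<close> \<open>0 < K\<close> \<open>0 < L\<close>
        by (simp add: rate_of_convergence_def N_def)
      then have "K * (h m * L) \<le> \<delta> / 3"
        using \<open>0 < K\<close> \<open>0 < L\<close> by (simp add: field_simps)
      then have "2 * \<alpha> m * (2 / 3 * \<delta>) \<le> 2 * \<alpha> m * (\<delta> - K * (h m * L))"
        using a_nonneg by (intro mult_left_mono) auto
      moreover have "2 * \<alpha> m * (2 / 3 * \<delta>) = (4 / 3 * \<delta>) * \<alpha> m"
        by simp
      ultimately show ?thesis
        by linarith
    qed
    have "K\<^sup>2 / \<delta> \<le> (\<Sum>i=N..M. \<alpha> i)"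
      using div \<open>0 < K\<close> \<open>0 < \<delta>\<close> by (simp add: rate_of_divergence_def M_def)
    then have "4 / 3 * K\<^sup>2 \<le> (4 / 3 * \<delta>) * (\<Sum>i=N..M. \<alpha> i)"
      using \<open>0 < \<delta>\<close> by (simp add: field_simps)
    moreover have "(norm (x N - q))\<^sup>2 \<le> K\<^sup>2"
      using bounded by (intro power_mono) auto
    moreover have "0 < K\<^sup>2"
      using \<open>0 < K\<close> by simp
    \<comment> \<open>Strictness comes from the surplus of \<open>4 / 3 * K\<^sup>2\<close> over
      \<open>K\<^sup>2\<close>.\<close>
    ultimately have large: "(norm (x N - q))\<^sup>2 < (4 / 3 * \<delta>) * (\<Sum>i=N..M. \<alpha> i)"
      by linarith
    \<comment> \<open>The \<open>+ 1\<close> in the rate appears here: step \<open>M\<close>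
      controls the iterate with index \<open>Suc M\<close>.\<close>
    have "Suc M \<le> n"
      using n by (simp add: Phi_rate_def Let_def M_def N_def L_def \<delta>_def K_def)
    then show ?thesis
      using a_nonneg \<open>0 < \<epsilon>\<close> \<open>0 < \<delta>\<close>
      by (intro le_of_descent[where b = "\<lambda>n. norm (x n - q)", OF _ _ _ _ descent large]) auto
  qed
  then have "rate_of_convergence (Phi_rate \<Theta> \<phi> \<xi>s r K0 K1 K2) (\<lambda>n. norm (x n - q))"
    by (simp add: rate_of_convergence_def)
  moreover have "(\<lambda>n. norm (x n - q)) \<longlonglongrightarrow> 0"
  proof (rule LIMSEQ_I)
    fix e :: real
    assume "0 < e"
    \<comment> \<open>The rate gives only a non-strict bound, hence \<open>e / 2\<close>.\<close>
    then show "\<exists>n0. \<forall>n\<ge>n0. norm (norm (x n - q) - 0) < e"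
      using rate[of "e / 2"] by (intro exI[of _ "Phi_rate \<Theta> \<phi> \<xi>s r K0 K1 K2 (e / 2)"]) force
  qed
  ultimately show ?thesis
    by simp
qed

end
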